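(* Let $m,n\in\mathbb{N}$, let $(i_1,\dots,i_m)\in\mathscr{D}_n^m\cup\mathscr{F}_n^m$, and let $\mathcal{B}=(b_{p_1\dots p_m})\in\mathbb{D}^{i_1\dots i_m}_{m,n}$. (i) If $(i_1,\dots,i_m)\in\mathscr{D}_n^m$, let $((j_1,\dots,j_l),\alpha=(\alpha_1,\dots,\alpha_l))$ be the tight pair associated with $(i_1,\dots,i_m)$ and let $c=\prod_{k=1}^{l}\binom{m-1}{\alpha-e_k}^{\alpha_k}$. Then $\mathcal{B}\in GDD^+_{m,n}$ if and only if $$\prod_{k=1}^{l} b_{j_kj_k\dots j_k}^{\alpha_k}\ \ge\ c\,|b_{i_1\dots i_m}|^m$$ and $b_{pp\dots p}\ge 0$ for all $(p,p,\dots,p)\in\mathscr{Q}_{i_1\dots i_m}$. (ii) If $(i_1,\dots,i_m)\in\mathscr{F}_n^m$, then $\mathcal{B}\in GDD^+_{m,n}$ if and only if $\mathcal{B}$ is a diagonal tensor satisfying $b_{i_1\dots i_m}\ge 0$.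
   Context: $\mathbb{S}_{m,n}$ is the set of real symmetric tensors $\mathcal{A}=(a_{i_1\dots i_m})$ of order $m$ and dimension $n$ (indices in $[n]=\{1,\dots,n\}$, entries invariant under permutations of the indices). The diagonal elements are the entries $a_{ii\dots i}$; a diagonal tensor is one whose off-diagonal elements are all zero. A tensor $\mathcal{A}$ is diagonally dominant (DD) if $|a_{ii\dots i}|\ge\sum_{(i_2,\dots,i_m)\ne(i,\dots,i)}|a_{ii_2\dots i_m}|$ for all $i\in[n]$. It is generalized diagonally dominant (GDD) if there is a diagonal matrix $D$ with positive diagonal entries $d_1,\dots,d_n$ such that the tensor with entries $a_{i_1\dots i_m}d_{i_1}^{1-m}d_{i_2}\cdots d_{i_m}$ is DD. $GDD^+_{m,n}$ is the set of GDD tensors in $\mathbb{S}_{m,n}$ with nonnegative diagonal elements. $\mathscr{D}_n^m$ is the set of $(i_1,\dots,i_m)$ with $1\le i_1\le\cdots\le i_m\le n$ that are not all equal; $\mathscr{F}_n^m=\{(i,i,\dots,i): i\in[n]\}$ ($m$-tuples). $\mathscr{P}_{i_1\dots i_m}$ is the set of all permutations of $(i_1,\dots,i_m)$ and $\mathscr{Q}_{i_1\dots i_m}=\{(p,p,\dots,p): p\in\{i_1,\dots,i_m\}\}$. $\mathbb{D}^{i_1\dots i_m}_{m,n}$ is the set of $(a_{j_1\dots j_m})\in\mathbb{S}_{m,n}$ with $a_{j_1\dots j_m}=0$ whenever $(j_1,\dots,j_m)\notin\mathscr{P}_{i_1\dots i_m}\cup\mathscr{Q}_{i_1\dots i_m}$.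 The tight pair of $(i_1,\dots,i_m)\in\mathscr{D}_n^m$ is $((j_1,\dots,j_l),(\alpha_1,\dots,\alpha_l))\in[n]^l\times[m]^l$, where $j_1<\dots<j_l$ are the distinct values among $i_1,\dots,i_m$ and $\alpha_k\ge1$ is the multiplicity of $j_k$, i.e. $x_{i_1}\cdots x_{i_m}=x_{j_1}^{\alpha_1}\cdots x_{j_l}^{\alpha_l}$. $e_k$ is the $k$-th standard unit vector of $\mathbb{R}^l$, and $\binom{m-1}{\beta}=\frac{(m-1)!}{\beta_1!\cdots\beta_l!}$ is the multinomial coefficient. *)

theory Defs
  imports Complex_Main "HOL-Library.Multiset" "HOL-Library.FuncSet"
begin

text \<open>
  A real tensor of order \<open>m\<close> and dimension \<open>n\<close> is a function on index lists of length \<open>m\<close> over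
  \<open>{1..n}\<close>, extensional outside of them, so that equal tensors are equal functions.
\<close>

definition index_set :: "nat \<Rightarrow> nat \<Rightarrow> nat list set" where
  "index_set m n = {is. length is = m \<and> set is \<subseteq> {1..n}}"

definition tensors :: "nat \<Rightarrow> nat \<Rightarrow> (nat list \<Rightarrow> real) set" where
  "tensors m n = index_set m n \<rightarrow>\<^sub>E UNIV"

definition perm_indices :: "nat list \<Rightarrow> nat list set" where
  "perm_indices is = {js. mset js = mset is}"

definition diag_indices :: "nat list \<Rightarrow> nat list set" where
  "diag_indices is = {replicate (length is) p | p. p \<in> set is}"

definition symmetric_tensors :: "nat \<Rightarrow> nat \<Rightarrow> (nat list \<Rightarrow> real) set" where
  "symmetric_tensors m n =
     {A \<in> tensors m n. \<forall>is\<in>index_set m n. \<forall>js\<in>perm_indices is. A js = A is}"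

definition constant_indices :: "nat \<Rightarrow> nat \<Rightarrow> nat list set" where
  "constant_indices m n = {replicate m i | i. i \<in> {1..n}}"

definition sorted_nonconstant_indices :: "nat \<Rightarrow> nat \<Rightarrow> nat list set" where
  "sorted_nonconstant_indices m n =
     {is \<in> index_set m n. sorted is \<and> (\<exists>p\<in>set is. \<exists>q\<in>set is. p \<noteq> q)}"

definition diagonal_tensor :: "nat \<Rightarrow> nat \<Rightarrow> (nat list \<Rightarrow> real) \<Rightarrow> bool" where
  "diagonal_tensor m n A \<longleftrightarrow>
     A \<in> tensors m n \<and> (\<forall>is \<in> index_set m n - constant_indices m n. A is = 0)"

definition diagonally_dominant :: "nat \<Rightarrow> nat \<Rightarrow> (nat list \<Rightarrow> real) \<Rightarrow> bool" where
  "diagonally_dominant m n A \<longleftrightarrow>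
     (\<forall>i\<in>{1..n}. \<bar>A (replicate m i)\<bar> \<ge>
        (\<Sum>js \<in> index_set (m - 1) n - {replicate (m - 1) i}. \<bar>A (i # js)\<bar>))"

text \<open>The diagonal matrix is given by its diagonal \<open>d\<close>, of which only the values on \<open>{1..n}\<close> are used.\<close>

definition diag_scale :: "nat \<Rightarrow> nat \<Rightarrow> (nat \<Rightarrow> real) \<Rightarrow> (nat list \<Rightarrow> real) \<Rightarrow> nat list \<Rightarrow> real" where
  "diag_scale m n d A =
     (\<lambda>is\<in>index_set m n. A is * d (hd is) powi (1 - int m) * prod_list (map d (tl is)))"

definition generalized_diagonally_dominant :: "nat \<Rightarrow> nat \<Rightarrow> (nat list \<Rightarrow> real) \<Rightarrow> bool" where
  "generalized_diagonally_dominant m n A \<longleftrightarrow>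
     (\<exists>d. (\<forall>i\<in>{1..n}. d i > 0) \<and> diagonally_dominant m n (diag_scale m n d A))"

definition GDD_plus :: "nat \<Rightarrow> nat \<Rightarrow> (nat list \<Rightarrow> real) set" where
  "GDD_plus m n =
     {A \<in> symmetric_tensors m n.
        generalized_diagonally_dominant m n A \<and> (\<forall>i\<in>{1..n}. A (replicate m i) \<ge> 0)}"

definition supported_tensors :: "nat \<Rightarrow> nat \<Rightarrow> nat list \<Rightarrow> (nat list \<Rightarrow> real) set" where
  "supported_tensors m n is =
     {A \<in> symmetric_tensors m n.
        \<forall>js \<in> index_set m n - (perm_indices is \<union> diag_indices is). A js = 0}"

definition tight_pair :: "nat list \<Rightarrow> nat list \<times> nat list" where
  "tight_pair is =
     (let js = sorted_list_of_set (set is) in (js, map (count_list is) js))"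

definition multinomial :: "nat \<Rightarrow> nat list \<Rightarrow> real" where
  "multinomial N \<beta> = fact N / (\<Prod>k<length \<beta>. fact (\<beta> ! k))"

text \<open>
  \<open>\<alpha> - e\<^sub>k\<close>, with \<open>k\<close> counted from 0. The truncated subtraction is exact for the multiplicities
  of a tight pair, which are all positive.
\<close>

definition minus_unit :: "nat list \<Rightarrow> nat \<Rightarrow> nat list" where
  "minus_unit \<alpha> k = \<alpha>[k := \<alpha> ! k - 1]"

end

theory Submission
  imports Defs "HOL-Combinatorics.Multiset_Permutations"
begin

text \<open>
  For nonconstant \<open>ix\<close>, all nonzero off-diagonal entries of \<open>B\<close> are at rearrangements of \<open>ix\<close>,
  where \<open>B\<close> has the value \<open>B ix\<close> throughout. Row \<open>i\<close> contains \<open>N\<^sub>i\<close> of them, where \<open>N\<^sub>i\<close> counts the rearrangements of \<open>ix\<close>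
  with one \<open>i\<close> removed and is therefore the multinomial coefficient of \<open>\<alpha> - e\<^sub>k\<close> when
  \<open>i = j\<^sub>k\<close> (\<open>multinomial_tight_pair\<close>). Scaling by \<open>d\<close> multiplies each of them by the same factor
  \<open>P / d\<^sub>i\<^sup>m\<close>, with \<open>P\<close> the product of \<open>d\<close> along \<open>ix\<close>, and fixes the diagonal entry \<open>a\<^sub>i\<close>. Diagonal
  dominance of the scaled tensor thus amounts to
  \<open>N\<^sub>i * \<bar>B ix\<bar> * P \<le> \<bar>a\<^sub>i\<bar> * d\<^sub>i\<^sup>m\<close> for all \<open>i\<close> occurring in \<open>ix\<close>
  (\<open>diagonally_dominant_diag_scale_iff\<close>).

  Multiplying these inequalities along \<open>ix\<close>, that is with the multiplicities \<open>\<alpha>\<close> as exponents,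
  produces \<open>P\<^sup>m\<close> on both sides; it cancels, and the asserted inequality between the entries of \<open>B\<close>
  remains (\<open>scaling_necessary\<close>). Conversely, if \<open>B ix \<noteq> 0\<close>, that inequality forces every \<open>a\<^sub>i\<close> to be
  positive, and \<open>d\<^sub>i = (N\<^sub>i / a\<^sub>i)\<^bsup>1/m\<^esup>\<close> turns all the row inequalities into the single one
  \<open>\<bar>B ix\<bar> * P \<le> 1\<close>, whose \<open>m\<close>-th power is the assumption because \<open>P\<^sup>m\<close> is the
  product of the \<open>N\<^sub>i / a\<^sub>i\<close> along \<open>ix\<close> (\<open>scaling_sufficient\<close>).

  Products over the tight pair are handled as products along the list \<open>ix\<close> itself
  (\<open>tight_pair_prod\<close>), where the multiplicities need no bookkeeping. For constant \<open>ix\<close> the tensor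
  has at most one nonzero entry, a diagonal one, and \<open>d = 1\<close> witnesses generalized diagonal
  dominance.
\<close>

section \<open>Products along a list\<close>

lemma prod_list_map_pos:
  fixes f :: "'a \<Rightarrow> real"
  assumes "\<And>x. x \<in> set xs \<Longrightarrow> 0 < f x"
  shows "0 < prod_list (map f xs)"
  using assms by (induction xs) auto

lemma prod_list_map_nonneg:
  fixes f :: "'a \<Rightarrow> real"
  assumes "\<And>x. x \<in> set xs \<Longrightarrow> 0 \<le> f x"
  shows "0 \<le> prod_list (map f xs)"
  using assms by (induction xs) auto

lemma prod_list_map_le:
  fixes f g :: "'a \<Rightarrow> real"
  assumes "\<And>x. x \<in> set xs \<Longrightarrow> 0 \<le> f x" and "\<And>x. x \<in> set xs \<Longrightarrow> f x \<le> g x"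
  shows "prod_list (map f xs) \<le> prod_list (map g xs)"
  using assms
proof (induction xs)
  case (Cons x xs)
  have "0 \<le> prod_list (map f xs)"
    by (rule prod_list_map_nonneg) (simp add: Cons.prems)
  moreover have "0 \<le> f x" "f x \<le> g x"
    by (simp_all add: Cons.prems)
  moreover have "prod_list (map f xs) \<le> prod_list (map g xs)"
    by (rule Cons.IH) (simp_all add: Cons.prems)
  ultimately show ?case
    by (auto intro!: mult_mono)
qed simp

lemma prod_list_map_mult:
  fixes f g :: "'a \<Rightarrow> real"
  shows "prod_list (map (\<lambda>x. f x * g x) xs) = prod_list (map f xs) * prod_list (map g xs)"
  by (induction xs) auto

lemma prod_list_map_power:
  fixes f :: "'a \<Rightarrow> real"
  shows "prod_list (map (\<lambda>x. f x ^ k) xs) = prod_list (map f xs) ^ k"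
  by (induction xs) (auto simp: power_mult_distrib)

lemma prod_list_map_const:
  fixes c :: real
  shows "prod_list (map (\<lambda>x. c) xs) = c ^ length xs"
  by (induction xs) auto

lemma prod_list_map_cong_mset:
  fixes f :: "'a \<Rightarrow> real"
  assumes "mset xs = mset ys"
  shows "prod_list (map f xs) = prod_list (map f ys)"
  using assms by (metis mset_map prod_mset_prod_list)

section \<open>Solvability of the scaling inequalities\<close>

text \<open>
  The product along \<open>xs\<close> of the constant factor \<open>P = prod_list (map d xs)\<close> and that of the factors
  \<open>d i ^ length xs\<close> are both \<open>P ^ length xs\<close>, so multiplying the inequalities eliminates \<open>d\<close>.
\<close>

lemma scaling_necessary:
  fixes N a d :: "'a \<Rightarrow> real"
  assumes "0 \<le> b"
    and "\<And>i. i \<in> set xs \<Longrightarrow> 0 < N i"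
    and d: "\<And>i. i \<in> set xs \<Longrightarrow> 0 < d i"
    and le: "\<And>i. i \<in> set xs \<Longrightarrow> N i * (b * prod_list (map d xs)) \<le> a i * d i ^ length xs"
  shows "prod_list (map N xs) * b ^ length xs \<le> prod_list (map a xs)"
proof -
  define P where "P = prod_list (map d xs)"
  have P: "0 < P"
    unfolding P_def by (rule prod_list_map_pos) (rule d)
  have "prod_list (map (\<lambda>i. N i * (b * P)) xs) \<le> prod_list (map (\<lambda>i. a i * d i ^ length xs) xs)"
    using assms P by (intro prod_list_map_le) (auto simp: P_def less_imp_le)
  then have "prod_list (map N xs) * b ^ length xs * P ^ length xs
      \<le> prod_list (map a xs) * P ^ length xs"
    by (simp add: prod_list_map_mult prod_list_map_power prod_list_map_const power_mult_distrib
        P_def mult.assoc)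
  then show ?thesis
    using P by simp
qed

text \<open>
  The choice \<open>d i = root m (N i / a i)\<close>, with \<open>m = length xs\<close>, makes \<open>a i * d i ^ m = N i\<close>, so that
  \<open>N i\<close> cancels and \<open>b * P \<le> 1\<close> is all that has to be shown, where \<open>P\<close> is the product of \<open>d\<close> along
  \<open>xs\<close>. It needs \<open>a i > 0\<close>, which can fail only for \<open>b = 0\<close>, when any \<open>d\<close> will do.
  Making \<open>d\<close> positive everywhere, with value 1 off \<open>xs\<close>, gives a diagonal matrix of any larger
  size.
\<close>

lemma scaling_sufficient:
  fixes N a :: "'a \<Rightarrow> real"
  assumes "xs \<noteq> []"
    and b: "0 \<le> b"
    and N: "\<And>i. i \<in> set xs \<Longrightarrow> 0 < N i"
    and a: "\<And>i. i \<in> set xs \<Longrightarrow> 0 \<le> a i"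
    and le: "prod_list (map N xs) * b ^ length xs \<le> prod_list (map a xs)"
  obtains d :: "'a \<Rightarrow> real" where "\<And>i. 0 < d i"
    and "\<And>i. i \<in> set xs \<Longrightarrow> N i * (b * prod_list (map d xs)) \<le> a i * d i ^ length xs"
proof (cases "b = 0")
  case True
  show thesis
    by (rule that[of "\<lambda>_. 1"]) (use True a in auto)
next
  case False
  define m where "m = length xs"
  have m: "m > 0"
    using assms(1) by (simp add: m_def)
  have "0 < prod_list (map N xs) * b ^ m"
    using b False by (intro mult_pos_pos prod_list_map_pos N) auto
  then have "0 < prod_list (map a xs)"
    using le by (simp add: m_def)
  then have "0 \<notin> a ` set xs"
    by (metis less_irrefl prod_list_zero_iff set_map)
  then have apos: "0 < a i" if "i \<in> set xs" for i
    using a[OF that] that by (metis imageI less_eq_real_def)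
  define d where "d i = (if i \<in> set xs then root m (N i / a i) else 1)" for i
  have d: "0 < d i" for i
    using N apos m by (simp add: d_def)
  have dm: "a i * d i ^ m = N i" if "i \<in> set xs" for i
    using that m N[OF that] apos[OF that] by (simp add: d_def real_root_pow_pos2)
  define P where "P = prod_list (map d xs)"
  have P: "0 < P"
    unfolding P_def by (rule prod_list_map_pos) (rule d)
  \<comment> \<open>Multiplying the equations \<open>dm\<close> along \<open>xs\<close> expresses \<open>P ^ m\<close> by \<open>N\<close> and \<open>a\<close>.\<close>
  have "prod_list (map a xs) * P ^ m = prod_list (map (\<lambda>i. a i * d i ^ m) xs)"
    by (simp add: prod_list_map_mult prod_list_map_power P_def)
  also have "\<dots> = prod_list (map N xs)"
    using dm by (intro arg_cong[where f = prod_list]) auto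
  finally have aP: "prod_list (map a xs) * P ^ m = prod_list (map N xs)" .
  have Npos: "0 < prod_list (map N xs)"
    by (rule prod_list_map_pos) (rule N)
  have "prod_list (map N xs) * b ^ m * P ^ m \<le> prod_list (map a xs) * P ^ m"
    using le P by (intro mult_right_mono) (auto simp: m_def)
  then have "prod_list (map N xs) * (b * P) ^ m \<le> prod_list (map N xs) * 1"
    by (simp add: aP power_mult_distrib mult.assoc)
  then have "(b * P) ^ m \<le> 1"
    using Npos by simp
  then have bP: "b * P \<le> 1"
    using m one_less_power[of "b * P" m] by (metis not_le)
  show thesis
  proof (rule that[of d])
    fix i assume i: "i \<in> set xs"
    have "N i * (b * P) \<le> N i * 1"
      using bP N[OF i] by (intro mult_left_mono) auto
    then show "N i * (b * prod_list (map d xs)) \<le> a i * d i ^ length xs"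
      using dm[OF i] by (simp add: P_def m_def)
  qed (rule d)
qed

section \<open>Counting the entries of a row\<close>

definition row_perms :: "nat list \<Rightarrow> nat \<Rightarrow> nat list set" where
  "row_perms ix i = {js. mset (i # js) = mset ix}"

lemma row_perms_eq:
  assumes "i \<in> set ix"
  shows "row_perms ix i = permutations_of_multiset (mset ix - {#i#})"
  using assms by (auto simp: row_perms_def permutations_of_multiset_def)
    (metis add_mset_remove_trivial)

lemma card_row_perms_pos:
  assumes "i \<in> set ix"
  shows "0 < card (row_perms ix i)"
  by (simp add: row_perms_eq[OF assms] card_gt_0_iff)

text \<open>
  The entries of \<open>\<alpha> - e\<^sub>k\<close> are the multiplicities in \<open>ix\<close> with one \<open>j\<^sub>k\<close> removed, so both sides count
  the rearrangements of that multiset. If \<open>j\<^sub>k\<close> disappears from it, the tight pair still lists the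
  multiplicity 0, which contributes the factor \<open>0! = 1\<close>.
\<close>

lemma multinomial_tight_pair:
  assumes tp: "tight_pair ix = (js, \<alpha>)" and k: "k < length js"
  shows "multinomial (length ix - 1) (minus_unit \<alpha> k) = real (card (row_perms ix (js ! k)))"
proof -
  define M where "M = mset ix - {#js ! k#}"
  have js: "js = sorted_list_of_set (set ix)" and \<alpha>: "\<alpha> = map (count_list ix) js"
    using tp by (auto simp: tight_pair_def Let_def)
  have dist: "distinct js" and set_js: "set js = set ix"
    by (auto simp: js)
  have mem: "js ! k \<in> set ix"
    using k set_js nth_mem by blast
  have nth: "minus_unit \<alpha> k ! q = count M (js ! q)" if "q < length js" for q
    using that k dist
    by (auto simp: minus_unit_def \<alpha> M_def count_mset nth_list_update nth_eq_iff_index_eq)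
  have "(\<Prod>q<length (minus_unit \<alpha> k). fact (minus_unit \<alpha> k ! q) :: real)
      = (\<Prod>q<length js. fact (count M (js ! q)))"
    by (rule prod.cong) (auto simp: nth, simp_all add: minus_unit_def \<alpha>)
  also have "\<dots> = (\<Prod>i\<in>set js. fact (count M i))"
    by (rule prod.reindex_bij_betw) (rule bij_betw_nth, use dist in auto)
  also have "\<dots> = (\<Prod>i\<in>set_mset M. fact (count M i))"
    by (rule prod.mono_neutral_right)
      (auto simp: set_js M_def not_in_iff dest: in_diffD)
  finally have prod_eq: "(\<Prod>q<length (minus_unit \<alpha> k). fact (minus_unit \<alpha> k ! q) :: real)
      = real (\<Prod>i\<in>set_mset M. fact (count M i))"
    by simp
  have size: "size M = length ix - 1"
    using mem by (simp add: M_def size_Diff_singleton)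
  have "real (card (row_perms ix (js ! k)))
      = real (fact (size M) div (\<Prod>i\<in>set_mset M. fact (count M i)))"
    by (simp add: row_perms_eq[OF mem] card_permutations_of_multiset M_def)
  also have "\<dots> = real (fact (size M)) / real (\<Prod>i\<in>set_mset M. fact (count M i))"
    by (rule real_of_nat_div) (rule card_permutations_of_multiset)
  finally show ?thesis
    unfolding multinomial_def prod_eq size by simp
qed

lemma tight_pair_prod:
  fixes f :: "nat \<Rightarrow> real"
  assumes tp: "tight_pair ix = (js, \<alpha>)"
  shows "(\<Prod>k<length js. f (js ! k) ^ (\<alpha> ! k)) = prod_list (map f ix)"
proof -
  have js: "js = sorted_list_of_set (set ix)" and \<alpha>: "\<alpha> = map (count_list ix) js"
    using tp by (auto simp: tight_pair_def Let_def)
  have "(\<Prod>k<length js. f (js ! k) ^ (\<alpha> ! k))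
      = (\<Prod>k<length js. f (js ! k) ^ count (mset ix) (js ! k))"
    by (rule prod.cong) (auto simp: \<alpha> count_mset)
  also have "\<dots> = (\<Prod>i\<in>set js. f i ^ count (mset ix) i)"
    by (rule prod.reindex_bij_betw[where g = "\<lambda>i. f i ^ count (mset ix) i"])
      (rule bij_betw_nth, auto simp: js)
  also have "\<dots> = prod_mset (image_mset f (mset ix))"
    by (simp add: image_prod_mset_multiplicity js)
  also have "\<dots> = prod_list (map f ix)"
    by (metis mset_map prod_mset_prod_list)
  finally show ?thesis .
qed

section \<open>Diagonal dominance of scaled supported tensors\<close>

lemma finite_index_set: "finite (index_set m n)"
proof -
  have "index_set m n = {is. set is \<subseteq> {1..n} \<and> length is = m}"
    by (auto simp: index_set_def)
  then show ?thesis
    by (simp add: finite_lists_length_eq)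
qed

lemma constant_in_index_set: "i \<in> {1..n} \<Longrightarrow> replicate m i \<in> index_set m n"
  by (auto simp: index_set_def)

lemma prod_list_map_replicate:
  fixes d :: "'a \<Rightarrow> real"
  shows "prod_list (map d (replicate k i)) = d i ^ k"
  by (induction k) auto

lemma diag_scale_constant:
  assumes "m \<ge> 1" "i \<in> {1..n}" "0 < d i"
  shows "diag_scale m n d A (replicate m i) = A (replicate m i)"
proof -
  obtain k where k: "m = Suc k"
    using assms(1) by (cases m) auto
  have "d i powi (1 - int m) * d i ^ k = 1"
    using assms(3) by (simp add: k power_int_minus)
  then show ?thesis
    using constant_in_index_set[OF assms(2), of m]
    by (simp add: diag_scale_def k prod_list_map_replicate)
qed

text \<open>
  Completing the product over the tail by \<open>d i\<close> makes the scaling factor depend on the tail only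
  through a product invariant under permutations of the whole index.
\<close>

lemma diag_scale_row:
  assumes "i # js \<in> index_set m n" "0 < d i"
  shows "diag_scale m n d A (i # js) = A (i # js) * prod_list (map d (i # js)) / d i ^ m"
proof -
  obtain k where k: "m = Suc k"
    using assms(1) by (cases m) (auto simp: index_set_def)
  show ?thesis
    using assms by (simp add: diag_scale_def k power_int_minus field_simps)
qed

lemma nonconstant_neq_replicate:
  assumes "p \<in> set ix" "q \<in> set ix" "p \<noteq> q"
  shows "mset (replicate k i) \<noteq> mset ix"
proof
  assume "mset (replicate k i) = mset ix"
  then have "set ix = set (replicate k i)"
    by (metis set_mset_mset)
  then show False
    using assms by auto
qed

text \<open>
  The support consists of rearrangements of \<open>ix\<close> and constant indices, and the constant index of row
  \<open>i\<close> is excluded from the sum. Only the tails completing \<open>i\<close> to a rearrangement of \<open>ix\<close> remain, and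
  symmetry of \<open>B\<close> makes their contributions equal.
\<close>

lemma supported_row_sum:
  assumes ix: "ix \<in> sorted_nonconstant_indices m n"
    and B: "B \<in> supported_tensors m n ix"
    and i: "i \<in> {1..n}" and d: "\<And>j. j \<in> {1..n} \<Longrightarrow> 0 < d j"
  shows "(\<Sum>js \<in> index_set (m - 1) n - {replicate (m - 1) i}. \<bar>diag_scale m n d B (i # js)\<bar>)
    = real (card (row_perms ix i)) * (\<bar>B ix\<bar> * prod_list (map d ix)) / d i ^ m"
proof -
  let ?R = "index_set (m - 1) n - {replicate (m - 1) i}"
  obtain p q where pq: "p \<in> set ix" "q \<in> set ix" "p \<noteq> q"
    and len: "length ix = m" and sub: "set ix \<subseteq> {1..n}"
    using ix by (auto simp: sorted_nonconstant_indices_def index_set_def)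
  have m: "m \<ge> 1"
    using pq(1) len by (cases ix) auto
  have ixI: "ix \<in> index_set m n"
    using len sub by (simp add: index_set_def)
  have cons: "i # js \<in> index_set m n" if "js \<in> index_set (m - 1) n" for js
    using that i m by (auto simp: index_set_def)
  have P: "0 < prod_list (map d ix)"
    using sub d by (intro prod_list_map_pos) auto
  have R: "row_perms ix i \<subseteq> ?R"
  proof
    fix js assume "js \<in> row_perms ix i"
    then have js: "mset (i # js) = mset ix"
      by (simp add: row_perms_def)
    have "length (i # js) = m" "set (i # js) = set ix"
      using mset_eq_length[OF js] mset_eq_setD[OF js] len by simp_all
    then have "js \<in> index_set (m - 1) n"
      using sub by (auto simp: index_set_def)
    moreover have "js \<noteq> replicate (m - 1) i"
      using js nonconstant_neq_replicate[OF pq, of "Suc (m - 1)" i] by auto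
    ultimately show "js \<in> ?R"
      by simp
  qed
  have zero: "diag_scale m n d B (i # js) = 0" if js: "js \<in> ?R - row_perms ix i" for js
  proof -
    have "i # js \<notin> diag_indices ix"
    proof
      assume "i # js \<in> diag_indices ix"
      then obtain r where "i # js = replicate m r"
        by (auto simp: diag_indices_def len)
      then show False
        using js by (cases m) auto
    qed
    moreover have "i # js \<notin> perm_indices ix"
      using js by (simp add: perm_indices_def row_perms_def)
    ultimately have "B (i # js) = 0"
      using B cons js by (auto simp: supported_tensors_def)
    then show ?thesis
      using cons js d[OF i] by (simp add: diag_scale_row)
  qed
  have val: "\<bar>diag_scale m n d B (i # js)\<bar> = \<bar>B ix\<bar> * prod_list (map d ix) / d i ^ m"
    if js: "js \<in> row_perms ix i" for js
  proof -
    have eq: "mset (i # js) = mset ix"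
      using js by (simp add: row_perms_def)
    have "i # js \<in> perm_indices ix"
      by (simp only: perm_indices_def mem_Collect_eq eq)
    then have "B (i # js) = B ix"
      using B ixI unfolding supported_tensors_def symmetric_tensors_def by blast
    moreover have "prod_list (map d (i # js)) = prod_list (map d ix)"
      by (rule prod_list_map_cong_mset) (rule eq)
    moreover have "i # js \<in> index_set m n"
      using R js by (intro cons) blast
    then have "diag_scale m n d B (i # js) = B (i # js) * prod_list (map d (i # js)) / d i ^ m"
      by (rule diag_scale_row) (rule d[OF i])
    ultimately have "diag_scale m n d B (i # js) = B ix * prod_list (map d ix) / d i ^ m"
      by (simp only:)
    then show ?thesis
      using P d[OF i] by (simp add: abs_mult)
  qed
  have "(\<Sum>js\<in>?R. \<bar>diag_scale m n d B (i # js)\<bar>)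
      = (\<Sum>js\<in>row_perms ix i. \<bar>diag_scale m n d B (i # js)\<bar>)"
    using R zero finite_index_set by (intro sum.mono_neutral_right) auto
  also have "\<dots> = (\<Sum>js\<in>row_perms ix i. \<bar>B ix\<bar> * prod_list (map d ix) / d i ^ m)"
    using val by (intro sum.cong) auto
  finally show ?thesis
    by simp
qed

text \<open>
  Rows whose number does not occur in \<open>ix\<close> impose no condition: their off-diagonal entries vanish.
\<close>

lemma diagonally_dominant_diag_scale_iff:
  assumes ix: "ix \<in> sorted_nonconstant_indices m n"
    and B: "B \<in> supported_tensors m n ix"
    and d: "\<And>j. j \<in> {1..n} \<Longrightarrow> 0 < d j"
  shows "diagonally_dominant m n (diag_scale m n d B) \<longleftrightarrow>
    (\<forall>i\<in>set ix. real (card (row_perms ix i)) * (\<bar>B ix\<bar> * prod_list (map d ix))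
        \<le> \<bar>B (replicate m i)\<bar> * d i ^ m)"
proof -
  have sub: "set ix \<subseteq> {1..n}" and m: "m \<ge> 1"
    using ix by (auto simp: sorted_nonconstant_indices_def index_set_def Suc_le_eq)
  let ?ineq = "\<lambda>i. real (card (row_perms ix i)) * (\<bar>B ix\<bar> * prod_list (map d ix))
        \<le> \<bar>B (replicate m i)\<bar> * d i ^ m"
  have "diagonally_dominant m n (diag_scale m n d B) \<longleftrightarrow> (\<forall>i\<in>{1..n}. ?ineq i)"
    unfolding diagonally_dominant_def
  proof (rule ball_cong[OF refl])
    fix i assume i: "i \<in> {1..n}"
    have row: "(\<Sum>js \<in> index_set (m - 1) n - {replicate (m - 1) i}. \<bar>diag_scale m n d B (i # js)\<bar>)
        = real (card (row_perms ix i)) * (\<bar>B ix\<bar> * prod_list (map d ix)) / d i ^ m"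
      by (rule supported_row_sum[OF ix B i d])
    have diag: "diag_scale m n d B (replicate m i) = B (replicate m i)"
      by (rule diag_scale_constant[where d = d, OF m i d[OF i]])
    have "0 < d i ^ m"
      using d[OF i] by simp
    then show "(\<Sum>js \<in> index_set (m - 1) n - {replicate (m - 1) i}. \<bar>diag_scale m n d B (i # js)\<bar>)
        \<le> \<bar>diag_scale m n d B (replicate m i)\<bar> \<longleftrightarrow> ?ineq i"
      by (simp only: row diag pos_divide_le_eq)
  qed
  moreover have "?ineq i" if "i \<in> {1..n}" "i \<notin> set ix" for i
  proof -
    have "row_perms ix i = {}"
      using that(2) unfolding row_perms_def by (auto dest: union_single_eq_member)
    then show ?thesis
      using d[OF that(1)] by simp
  qed
  ultimately show ?thesis
    using sub by auto
qed

text \<open>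
  This reduces nonnegativity of the whole diagonal, as required by \<open>GDD_plus\<close>, to nonnegativity on
  \<open>diag_indices ix\<close>.
\<close>

lemma supported_diagonal_zero:
  assumes ix: "ix \<in> sorted_nonconstant_indices m n"
    and B: "B \<in> supported_tensors m n ix"
    and i: "i \<in> {1..n}" "i \<notin> set ix"
  shows "B (replicate m i) = 0"
proof -
  obtain p q where pq: "p \<in> set ix" "q \<in> set ix" "p \<noteq> q" and len: "length ix = m"
    using ix by (auto simp: sorted_nonconstant_indices_def index_set_def)
  have "m \<noteq> 0"
    using pq(1) len by auto
  have "replicate m i \<notin> perm_indices ix"
    using nonconstant_neq_replicate[OF pq] by (simp add: perm_indices_def)
  moreover have "replicate m i \<notin> diag_indices ix"
    using i(2) \<open>m \<noteq> 0\<close> by (auto simp: diag_indices_def len)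
  ultimately show ?thesis
    using B constant_in_index_set[OF i(1)] by (auto simp: supported_tensors_def)
qed

lemma GDD_plus_nonconstant_iff:
  assumes ix: "ix \<in> sorted_nonconstant_indices m n"
    and B: "B \<in> supported_tensors m n ix"
  shows "B \<in> GDD_plus m n \<longleftrightarrow>
    prod_list (map (\<lambda>i. real (card (row_perms ix i))) ix) * \<bar>B ix\<bar> ^ m
      \<le> prod_list (map (\<lambda>i. B (replicate m i)) ix) \<and>
    (\<forall>ps\<in>diag_indices ix. 0 \<le> B ps)"
proof -
  let ?N = "\<lambda>i. real (card (row_perms ix i))" and ?a = "\<lambda>i. B (replicate m i)"
  have sub: "set ix \<subseteq> {1..n}" and len: "length ix = m" and ne: "ix \<noteq> []"
    using ix by (auto simp: sorted_nonconstant_indices_def index_set_def)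
  have N: "0 < ?N i" if "i \<in> set ix" for i
    using card_row_perms_pos[OF that] by simp
  have diag: "(\<forall>ps\<in>diag_indices ix. 0 \<le> B ps) \<longleftrightarrow> (\<forall>i\<in>set ix. 0 \<le> ?a i)"
    by (auto simp: diag_indices_def len)
  show ?thesis
    unfolding diag
  proof (intro iffI conjI)
    assume "B \<in> GDD_plus m n"
    then obtain d where d: "\<And>i. i \<in> {1..n} \<Longrightarrow> 0 < d i"
      and dd: "diagonally_dominant m n (diag_scale m n d B)"
      and nonneg: "\<forall>i\<in>{1..n}. 0 \<le> ?a i"
      unfolding GDD_plus_def generalized_diagonally_dominant_def by blast
    show nn: "\<forall>i\<in>set ix. 0 \<le> ?a i"
      using nonneg sub by auto
    have "prod_list (map ?N ix) * \<bar>B ix\<bar> ^ length ix \<le> prod_list (map ?a ix)"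
    proof (rule scaling_necessary[where d = d])
      fix i assume i: "i \<in> set ix"
      show "?N i * (\<bar>B ix\<bar> * prod_list (map d ix)) \<le> ?a i * d i ^ length ix"
        using dd diagonally_dominant_diag_scale_iff[where d = d, OF ix B d] i nn by (simp add: len)
    qed (use N d sub in auto)
    then show "prod_list (map ?N ix) * \<bar>B ix\<bar> ^ m \<le> prod_list (map ?a ix)"
      by (simp add: len)
  next
    assume "prod_list (map ?N ix) * \<bar>B ix\<bar> ^ m \<le> prod_list (map ?a ix) \<and> (\<forall>i\<in>set ix. 0 \<le> ?a i)"
    then have le: "prod_list (map ?N ix) * \<bar>B ix\<bar> ^ length ix \<le> prod_list (map ?a ix)"
      and nn: "\<And>i. i \<in> set ix \<Longrightarrow> 0 \<le> ?a i"
      by (auto simp: len)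
    obtain d where d: "\<And>i. 0 < d i"
      and "\<And>i. i \<in> set ix \<Longrightarrow> ?N i * (\<bar>B ix\<bar> * prod_list (map d ix)) \<le> ?a i * d i ^ length ix"
      using scaling_sufficient[OF ne abs_ge_zero N nn le] by blast
    then have "diagonally_dominant m n (diag_scale m n d B)"
      using nn by (simp add: diagonally_dominant_diag_scale_iff[where d = d, OF ix B d] len)
    moreover have "\<forall>i\<in>{1..n}. 0 \<le> ?a i"
      using nn supported_diagonal_zero[OF ix B] by (metis order_refl)
    ultimately show "B \<in> GDD_plus m n"
      using B d by (auto simp: GDD_plus_def generalized_diagonally_dominant_def supported_tensors_def)
  qed
qed

section \<open>Diagonal tensors\<close>

lemma diagonal_tensor_diagonally_dominant:
  assumes "m \<ge> 1" and A: "diagonal_tensor m n A"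
  shows "diagonally_dominant m n A"
  unfolding diagonally_dominant_def
proof
  fix i assume i: "i \<in> {1..n}"
  have "A (i # js) = 0" if js: "js \<in> index_set (m - 1) n - {replicate (m - 1) i}" for js
  proof -
    have "i # js \<in> index_set m n"
      using js i assms(1) by (auto simp: index_set_def)
    moreover have "i # js \<notin> constant_indices m n"
    proof
      assume "i # js \<in> constant_indices m n"
      then show False
        using js by (cases m) (auto simp: constant_indices_def)
    qed
    ultimately show ?thesis
      using A by (auto simp: diagonal_tensor_def)
  qed
  then show "(\<Sum>js \<in> index_set (m - 1) n - {replicate (m - 1) i}. \<bar>A (i # js)\<bar>)
      \<le> \<bar>A (replicate m i)\<bar>"
    by simp
qed

lemma diag_scale_one:
  assumes "A \<in> tensors m n"
  shows "diag_scale m n (\<lambda>_. 1) A = A"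
proof -
  have "prod_list (map (\<lambda>_. 1 :: real) xs) = 1" for xs :: "nat list"
    by (induction xs) auto
  then show ?thesis
    using assms by (auto simp: diag_scale_def tensors_def PiE_def extensional_def restrict_def fun_eq_iff)
qed

lemma GDD_plus_constant_iff:
  assumes m: "m \<ge> 1" and ix: "ix \<in> constant_indices m n"
    and B: "B \<in> supported_tensors m n ix"
  shows "B \<in> GDD_plus m n \<longleftrightarrow> diagonal_tensor m n B \<and> 0 \<le> B ix"
proof -
  obtain i where i: "i \<in> {1..n}" and ix_eq: "ix = replicate m i"
    using ix by (auto simp: constant_indices_def)
  have sym: "B \<in> symmetric_tensors m n"
    using B by (simp add: supported_tensors_def)
  then have T: "B \<in> tensors m n"
    by (simp add: symmetric_tensors_def)
  have "perm_indices ix \<union> diag_indices ix \<subseteq> {ix}"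
  proof -
    have "js = ix" if js: "mset js = mset ix" for js
    proof -
      have "length js = m" "set js \<subseteq> {i}"
        using mset_eq_length[OF js] mset_eq_setD[OF js] by (auto simp: ix_eq)
      then show ?thesis
        unfolding ix_eq by (intro replicate_eqI) auto
    qed
    then show ?thesis
      by (auto simp: perm_indices_def diag_indices_def ix_eq)
  qed
  then have zero: "B js = 0" if "js \<in> index_set m n" "js \<noteq> ix" for js
    using B that by (auto simp: supported_tensors_def)
  have diag: "diagonal_tensor m n B"
    using T zero ix by (auto simp: diagonal_tensor_def)
  then have "generalized_diagonally_dominant m n B"
    unfolding generalized_diagonally_dominant_def
    using diagonal_tensor_diagonally_dominant[OF m diag] diag_scale_one[OF T]
    by (intro exI[of _ "\<lambda>_. 1"]) simp
  moreover have "(\<forall>j\<in>{1..n}. 0 \<le> B (replicate m j)) \<longleftrightarrow> 0 \<le> B ix"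
    using zero constant_in_index_set i ix_eq by (metis order_refl)
  ultimately show ?thesis
    using sym diag by (simp add: GDD_plus_def)
qed

theorem theorem6:
  fixes m n :: nat and ix :: "nat list" and B :: "nat list \<Rightarrow> real"
  assumes "m \<ge> 1" and "n \<ge> 1"
    and "ix \<in> sorted_nonconstant_indices m n \<union> constant_indices m n"
    and "B \<in> supported_tensors m n ix"
  shows "(ix \<in> sorted_nonconstant_indices m n \<longrightarrow>
            (\<forall>js \<alpha> c. tight_pair ix = (js, \<alpha>) \<and>
               c = (\<Prod>k<length js. multinomial (m - 1) (minus_unit \<alpha> k) ^ (\<alpha> ! k)) \<longrightarrow>
               (B \<in> GDD_plus m n \<longleftrightarrow>
                  (\<Prod>k<length js. B (replicate m (js ! k)) ^ (\<alpha> ! k)) \<ge> c * \<bar>B ix\<bar> ^ m \<and>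
                  (\<forall>ps\<in>diag_indices ix. B ps \<ge> 0))))
       \<and> (ix \<in> constant_indices m n \<longrightarrow>
            (B \<in> GDD_plus m n \<longleftrightarrow> diagonal_tensor m n B \<and> B ix \<ge> 0))"
proof (intro conjI impI allI)
  fix js \<alpha> and c :: real
  assume ix: "ix \<in> sorted_nonconstant_indices m n"
    and "tight_pair ix = (js, \<alpha>) \<and>
      c = (\<Prod>k<length js. multinomial (m - 1) (minus_unit \<alpha> k) ^ (\<alpha> ! k))"
  then have tp: "tight_pair ix = (js, \<alpha>)"
    and c: "c = (\<Prod>k<length js. multinomial (m - 1) (minus_unit \<alpha> k) ^ (\<alpha> ! k))"
    by auto
  have len: "length ix = m"
    using ix by (simp add: sorted_nonconstant_indices_def index_set_def)
  have "c = (\<Prod>k<length js. real (card (row_perms ix (js ! k))) ^ (\<alpha> ! k))"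
    unfolding c using multinomial_tight_pair[OF tp] by (intro prod.cong) (auto simp: len)
  also have "\<dots> = prod_list (map (\<lambda>i. real (card (row_perms ix i))) ix)"
    by (rule tight_pair_prod[OF tp])
  finally have c_eq: "c = prod_list (map (\<lambda>i. real (card (row_perms ix i))) ix)" .
  show "B \<in> GDD_plus m n \<longleftrightarrow>
      (\<Prod>k<length js. B (replicate m (js ! k)) ^ (\<alpha> ! k)) \<ge> c * \<bar>B ix\<bar> ^ m \<and>
      (\<forall>ps\<in>diag_indices ix. B ps \<ge> 0)"
    unfolding c_eq tight_pair_prod[OF tp, where f = "\<lambda>i. B (replicate m i)"]
    by (rule GDD_plus_nonconstant_iff[OF ix assms(4)])
next
  assume "ix \<in> constant_indices m n"
  then show "B \<in> GDD_plus m n \<longleftrightarrow> diagonal_tensor m n B \<and> B ix \<ge> 0"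
    using GDD_plus_constant_iff assms(1,4) by blast
qed

end
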